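(* Let $B \in \mathbb{R}^{n\times n}$ be an arbitrary (not necessarily symmetric) matrix and let $F : \mathbb{R}^{n\times n} \to \mathbb{R}$ be a differentiable cost function of a matrix variable $H$. Define $\tilde F(P) = F(P^T B P)$ for $P \in \mathbb{R}^{n\times n}$, and let $P(t)$ be a solution in $\mathcal{O}_n$ of the gradient flow $\dot{P} = -\operatorname{grad} \tilde F(P)$. Then $H(t) = P(t)^T B P(t)$ satisfies $$\dot{H} = -\left[ H, \left\{ H, F_H \right\} + \left\{ H^T, F_H^T \right\} \right],$$ where $F_H$ is evaluated at $H(t)$.
   Context: $\mathcal{O}_n = \{ P \in \mathbb{R}^{n\times n} : P^T P = I\}$ is the set of orthogonal matrices. $[X, Y] = XY - YX$ is the standard Lie bracket and $\{X, Y\} = X^T Y - Y^T X$ the generalized Lie bracket. For a differentiable function $F$ of a matrix variable $X$, $F_X$ denotes the matrix of partial derivatives, $(F_X)_{ij} = \partial F/\partial X_{ij}$. The gradient of a function $\tilde F$ on the manifold of orthogonal matrices is defined as $\operatorname{grad}\tilde F(P) = \tilde F_P - P \tilde F_P^T P = P\{P, \tilde F_P\}$ for $P\in\mathcal{O}_n$. *)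

theory Defs
  imports "HOL-Analysis.Analysis"
begin

definition lie_bracket :: "real^'n^'n \<Rightarrow> real^'n^'n \<Rightarrow> real^'n^'n" where
  "lie_bracket X Y = X ** Y - Y ** X"

definition gen_lie_bracket :: "real^'n^'n \<Rightarrow> real^'n^'n \<Rightarrow> real^'n^'n" where
  "gen_lie_bracket X Y = transpose X ** Y - transpose Y ** X"

text \<open>\<^term>\<open>axis i (axis j 1)\<close> is the matrix unit with entry 1 in row \<open>i\<close>, column \<open>j\<close>.\<close>

definition matrix_gradient :: "(real^'n^'n \<Rightarrow> real) \<Rightarrow> real^'n^'n \<Rightarrow> real^'n^'n" where
  "matrix_gradient F X =
     (\<chi> i j. deriv (\<lambda>s. F (X + s *\<^sub>R axis i (axis j 1))) 0)"

definition orth_grad :: "(real^'n^'n \<Rightarrow> real) \<Rightarrow> real^'n^'n \<Rightarrow> real^'n^'n" where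
  "orth_grad F P =
     matrix_gradient F P - P ** transpose (matrix_gradient F P) ** P"

lemma orth_grad_eq:
  assumes "orthogonal_matrix P"
  shows "orth_grad F P = P ** gen_lie_bracket P (matrix_gradient F P)"
proof -
  have "P ** transpose P = mat 1"
    using assms by (simp add: orthogonal_matrix_def)
  then have "P ** (transpose P ** G) = G" for G :: "real^'a^'a"
    by (simp add: matrix_mul_assoc)
  moreover have "P ** (X - Y) = P ** X - P ** Y" for X Y :: "real^'a^'a"
    by (simp add: vec_eq_iff matrix_matrix_mult_def right_diff_distrib sum_subtractf)
  ultimately show ?thesis
    by (simp add: orth_grad_def gen_lie_bracket_def matrix_mul_assoc)
qed

text \<open>\<open>T\<close> is the time interval of the solution; one-sided derivatives are used at end points
  that belong to \<open>T\<close>.\<close>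

definition orth_gradient_flow ::
    "(real^'n^'n \<Rightarrow> real) \<Rightarrow> real set \<Rightarrow> (real \<Rightarrow> real^'n^'n) \<Rightarrow> bool" where
  "orth_gradient_flow F T P \<longleftrightarrow>
     (\<forall>t\<in>T. orthogonal_matrix (P t) \<and>
            (P has_vector_derivative - orth_grad F (P t)) (at t within T))"

end

theory Submission
  imports Defs
begin

text \<open>With \<open>G = F\<^sub>H\<close>, the chain rule and the Frobenius adjoints of left and right multiplication
  give \<open>F~\<^sub>P = B P G\<^sup>T + B\<^sup>T P G\<close>. Hence \<open>\<Omega> = {P, F~\<^sub>P} = {H, G} + {H\<^sup>T, G\<^sup>T}\<close> on orthogonal
  matrices. The flow is thus \<open>P' = - P \<Omega>\<close> with \<open>\<Omega>\<close> skew-symmetric, and the product rule for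
  \<open>P\<^sup>T B P\<close> gives \<open>H' = \<Omega> H - H \<Omega>\<close>.\<close>

lemma bounded_bilinear_matrix_matrix_mult:
  "bounded_bilinear ((**) :: real^'n^'m \<Rightarrow> real^'k^'n \<Rightarrow> real^'k^'m)"
  unfolding bilinear_conv_bounded_bilinear[symmetric] bilinear_def
  by (auto intro!: linearI
      simp: vec_eq_iff matrix_matrix_mult_def algebra_simps sum.distrib sum_distrib_left)

lemma bounded_linear_transpose:
  "bounded_linear (transpose :: real^'n^'m \<Rightarrow> real^'m^'n)"
  unfolding linear_conv_bounded_linear[symmetric]
  by (auto intro!: linearI simp: vec_eq_iff transpose_def)

lemmas matrix_mult_add_left = bounded_bilinear.add_left[OF bounded_bilinear_matrix_matrix_mult]
lemmas matrix_mult_add_right = bounded_bilinear.add_right[OF bounded_bilinear_matrix_matrix_mult]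
lemmas matrix_mult_minus_left = bounded_bilinear.minus_left[OF bounded_bilinear_matrix_matrix_mult]
lemmas matrix_mult_minus_right = bounded_bilinear.minus_right[OF bounded_bilinear_matrix_matrix_mult]
lemmas transpose_add = linear_add[OF bounded_linear.linear[OF bounded_linear_transpose]]
lemmas transpose_diff = linear_diff[OF bounded_linear.linear[OF bounded_linear_transpose]]
lemmas transpose_minus = linear_neg[OF bounded_linear.linear[OF bounded_linear_transpose]]

lemma inner_transpose_left:
  fixes X :: "real^'n^'m"
  shows "transpose X \<bullet> Y = X \<bullet> transpose Y"
  unfolding inner_vec_def transpose_def by (simp, rule sum.swap)

text \<open>The inner product on matrices is the Frobenius one, so both sides are the same triple
  sum; only the order of the two inner summations differs.\<close>

lemma inner_matrix_mult_right:
  fixes X :: "real^'n^'m" and A :: "real^'k^'n"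
  shows "(X ** A) \<bullet> Y = X \<bullet> (Y ** transpose A)"
proof -
  have "(\<Sum>j\<in>UNIV. \<Sum>k\<in>UNIV. X $ i $ k * A $ k $ j * Y $ i $ j)
      = (\<Sum>k\<in>UNIV. \<Sum>j\<in>UNIV. X $ i $ k * (Y $ i $ j * A $ k $ j))" for i
    by (subst sum.swap) (simp add: mult_ac)
  then show ?thesis
    by (simp add: inner_vec_def transpose_def matrix_matrix_mult_def
        sum_distrib_left sum_distrib_right)
qed

text \<open>Transposing both arguments preserves the inner product and turns left multiplication
  into right multiplication.\<close>

lemma inner_matrix_mult_left:
  fixes X :: "real^'n^'m" and A :: "real^'m^'k"
  shows "(A ** X) \<bullet> Y = X \<bullet> (transpose A ** Y)"
proof -
  have "(A ** X) \<bullet> Y = transpose (A ** X) \<bullet> transpose Y"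
    by (simp add: inner_transpose_left)
  also have "\<dots> = transpose X \<bullet> (transpose Y ** A)"
    by (simp add: matrix_transpose_mul inner_matrix_mult_right)
  also have "\<dots> = X \<bullet> (transpose A ** Y)"
    by (simp add: inner_transpose_left matrix_transpose_mul)
  finally show ?thesis .
qed

text \<open>Each partial derivative is the derivative along a matrix unit, and pairing
  \<open>G\<close> with a matrix unit picks out one entry of \<open>G\<close>.\<close>

lemma matrix_gradient_eqI:
  assumes "(F has_derivative (\<lambda>E. G \<bullet> E)) (at X)"
  shows "matrix_gradient F X = G"
proof -
  have "((\<lambda>s. F (X + s *\<^sub>R axis i (axis j 1))) has_field_derivative G $ i $ j) (at 0)" for i j
  proof -
    have "((\<lambda>s. X + s *\<^sub>R axis i (axis j 1)) has_derivative (\<lambda>s. s *\<^sub>R axis i (axis j 1))) (at 0)"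
      by (auto intro!: derivative_eq_intros)
    then have "((\<lambda>s. F (X + s *\<^sub>R axis i (axis j 1))) has_derivative
                (\<lambda>s. G \<bullet> (s *\<^sub>R axis i (axis j 1)))) (at 0)"
      by (rule has_derivative_compose) (simp add: assms)
    moreover have "(\<lambda>s. G \<bullet> (s *\<^sub>R axis i (axis j 1))) = (*) (G $ i $ j)"
      by (rule ext) (simp add: inner_axis)
    ultimately show ?thesis
      by (simp only: has_field_derivative_def)
  qed
  then show ?thesis
    by (simp add: matrix_gradient_def vec_eq_iff DERIV_imp_deriv)
qed

text \<open>The derivative is a linear functional, hence is represented by some matrix (Riesz); the
  preceding lemma identifies that matrix with the gradient.\<close>

lemma has_derivative_matrix_gradient:
  assumes "F differentiable at X"
  shows "(F has_derivative (\<lambda>E. matrix_gradient F X \<bullet> E)) (at X)"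
proof -
  obtain L where L: "(F has_derivative L) (at X)"
    using assms by (auto simp: differentiable_def)
  then have "linear L"
    by (rule has_derivative_linear)
  \<comment> \<open>The adjoint maps reals to matrices, and its value at 1 is the Riesz
    representative of \<open>L\<close>.\<close>
  then have "L = (\<lambda>E. adjoint L 1 \<bullet> E)"
    using adjoint_works[of L] by (simp add: inner_commute fun_eq_iff)
  then show ?thesis
    using L matrix_gradient_eqI by metis
qed

text \<open>The domain of \<open>P\<close> is kept general because the product rule serves twice:
  with \<open>P\<close> the identity on matrices, to differentiate the cost, and with
  \<open>P\<close> the solution curve on a time interval.\<close>

lemma has_derivative_congruence:
  fixes B :: "real^'n^'n" and P :: "'a::real_normed_vector \<Rightarrow> real^'k^'n"
  assumes "(P has_derivative P') (at x within S)"
  shows "((\<lambda>x. transpose (P x) ** B ** P x) has_derivative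
          (\<lambda>h. transpose (P x) ** B ** P' h + transpose (P' h) ** B ** P x)) (at x within S)"
proof -
  note mult = bounded_bilinear_matrix_matrix_mult
  have "((\<lambda>x. transpose (P x)) has_derivative (\<lambda>h. transpose (P' h))) (at x within S)"
    by (rule bounded_linear.has_derivative[OF bounded_linear_transpose assms])
  then have "((\<lambda>x. transpose (P x) ** B) has_derivative (\<lambda>h. transpose (P' h) ** B)) (at x within S)"
    by (rule bounded_linear.has_derivative[OF bounded_bilinear.bounded_linear_left[OF mult]])
  from bounded_bilinear.FDERIV[OF mult this assms] show ?thesis .
qed

lemma matrix_gradient_congruence:
  fixes B P :: "real^'n^'n"
  assumes "F differentiable at (transpose P ** B ** P)"
  defines "G \<equiv> matrix_gradient F (transpose P ** B ** P)"
  shows "matrix_gradient (\<lambda>Q. F (transpose Q ** B ** Q)) P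
       = B ** P ** transpose G + transpose B ** P ** G"
proof (rule matrix_gradient_eqI)
  have "((\<lambda>Q. F (transpose Q ** B ** Q)) has_derivative
         (\<lambda>E. G \<bullet> (transpose P ** B ** E + transpose E ** B ** P))) (at P)"
    unfolding G_def
    by (rule has_derivative_compose[OF has_derivative_congruence[OF has_derivative_ident]
          has_derivative_matrix_gradient[OF assms(1)]])
  moreover have "G \<bullet> (transpose P ** B ** E + transpose E ** B ** P)
      = (B ** P ** transpose G + transpose B ** P ** G) \<bullet> E" for E
  proof -
    have "(transpose P ** B ** E) \<bullet> G = E \<bullet> (transpose B ** P ** G)"
      by (simp add: inner_matrix_mult_left matrix_transpose_mul)
    \<comment> \<open>Here \<open>E\<close> enters transposed, so freeing it transposes the other
      factor as well; this is the source of \<open>transpose G\<close> in the gradient.\<close>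
    moreover have "(transpose E ** B ** P) \<bullet> G = E \<bullet> (B ** P ** transpose G)"
      by (simp add: inner_matrix_mult_right inner_transpose_left matrix_transpose_mul
          flip: matrix_mul_assoc)
    ultimately show ?thesis
      by (simp add: inner_add_left inner_add_right inner_commute)
  qed
  ultimately show "((\<lambda>Q. F (transpose Q ** B ** Q)) has_derivative
         (\<lambda>E. (B ** P ** transpose G + transpose B ** P ** G) \<bullet> E)) (at P)"
    by simp
qed

lemma transpose_gen_lie_bracket: "transpose (gen_lie_bracket X Y) = - gen_lie_bracket X Y"
  by (simp add: gen_lie_bracket_def transpose_diff matrix_transpose_mul)

text \<open>Both sides expand to \<open>H ** transpose G + transpose H ** G - G ** transpose H -
  transpose G ** H\<close>.\<close>

lemma gen_lie_bracket_congruence: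
  fixes B P G :: "real^'n^'n"
  defines "H \<equiv> transpose P ** B ** P"
  shows "gen_lie_bracket P (B ** P ** transpose G + transpose B ** P ** G)
       = gen_lie_bracket H G + gen_lie_bracket (transpose H) (transpose G)"
  by (simp add: gen_lie_bracket_def H_def transpose_add matrix_transpose_mul
      matrix_mult_add_left matrix_mult_add_right matrix_mul_assoc)

theorem theorem3:
  fixes B :: "real^'n^'n"
    and F :: "real^'n^'n \<Rightarrow> real"
    and P H :: "real \<Rightarrow> real^'n^'n"
    and T :: "real set"
  assumes "F differentiable_on UNIV"
    and "is_interval T"
    and "orth_gradient_flow (\<lambda>Q. F (transpose Q ** B ** Q)) T P"
    and "\<And>s. H s = transpose (P s) ** B ** P s"
    and "t \<in> T"
  shows "(H has_vector_derivative
           - lie_bracket (H t)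
               (gen_lie_bracket (H t) (matrix_gradient F (H t))
                + gen_lie_bracket (transpose (H t)) (transpose (matrix_gradient F (H t)))))
         (at t within T)"
proof -
  define \<Omega> where "\<Omega> = gen_lie_bracket (H t) (matrix_gradient F (H t))
    + gen_lie_bracket (transpose (H t)) (transpose (matrix_gradient F (H t)))"
  have skew: "transpose \<Omega> = - \<Omega>"
    by (simp add: \<Omega>_def transpose_add transpose_gen_lie_bracket)
  have "F differentiable at (H t)"
    using assms(1) by (simp add: differentiable_on_def)
  \<comment> \<open>Orthogonality of \<open>P t\<close>, part of the flow condition, gives the
    factored form of the gradient in \<open>orth_grad_eq\<close>.\<close>
  then have grad: "orth_grad (\<lambda>Q. F (transpose Q ** B ** Q)) (P t) = P t ** \<Omega>"
    using assms(3,5)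
    by (simp add: orth_gradient_flow_def orth_grad_eq matrix_gradient_congruence
        gen_lie_bracket_congruence \<Omega>_def assms(4))
  have "(P has_vector_derivative - orth_grad (\<lambda>Q. F (transpose Q ** B ** Q)) (P t)) (at t within T)"
    using assms(3,5) unfolding orth_gradient_flow_def by blast
  then have "(P has_derivative (\<lambda>h. h *\<^sub>R - (P t ** \<Omega>))) (at t within T)"
    by (simp only: grad has_vector_derivative_def)
  from has_derivative_congruence[OF this, of B]
  have "(H has_derivative
      (\<lambda>h. transpose (P t) ** B ** (h *\<^sub>R - (P t ** \<Omega>))
         + transpose (h *\<^sub>R - (P t ** \<Omega>)) ** B ** P t)) (at t within T)"
    by (simp only: assms(4)[abs_def])
  moreover have "transpose (P t) ** B ** (h *\<^sub>R - (P t ** \<Omega>))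
         + transpose (h *\<^sub>R - (P t ** \<Omega>)) ** B ** P t = h *\<^sub>R - lie_bracket (H t) \<Omega>" for h
  proof -
    have "transpose (P t) ** B ** (P t ** \<Omega>) = H t ** \<Omega>"
      by (simp add: assms(4) matrix_mul_assoc)
    \<comment> \<open>Skew-symmetry supplies the minus sign that makes the two product-rule terms
      combine to a commutator instead of a sum.\<close>
    moreover have "transpose (P t ** \<Omega>) ** B ** P t = - (\<Omega> ** H t)"
      by (simp add: assms(4) matrix_mul_assoc matrix_transpose_mul skew matrix_mult_minus_left)
    ultimately show ?thesis
      by (simp add: lie_bracket_def transpose_minus matrix_mult_minus_left matrix_mult_minus_right
          bounded_bilinear.scaleR_left[OF bounded_bilinear_matrix_matrix_mult]
          bounded_bilinear.scaleR_right[OF bounded_bilinear_matrix_matrix_mult]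
          linear_cmul[OF bounded_linear.linear[OF bounded_linear_transpose]]
          scaleR_diff_right)
  qed
  ultimately show ?thesis
    by (simp add: has_vector_derivative_def \<Omega>_def)
qed

end
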